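(* There is no strategy for sorting on a deque with incomplete information that succeeds on every permutation that is sortable on a deque. More precisely, there exist two permutations of $\{1,\dots,7\}$, both sortable on a deque with complete information, such that any strategy for the incomplete-information game fails to sort at least one of them.
   Context: Sorting on a deque: a permutation $\pi$ of $\{1,\dots,n\}$ is the input list; allowed operations are moving the first input element to the left or right end of a deque, and moving the left or right end element of the deque to the end of the output; $\pi$ is sortable on a deque (with complete information) if some sequence of operations ends with output $1,2,\dots,n$. In the incomplete-information version (the game "Double-Ended Knuth"), the input is a face-down deck: the player sees only the elements already revealed; the next input element is revealed when it becomes the top of the deck, and the player must then decide what to do with it (send it to the output if it is the next element required, or place it at one end of the deque) before seeing any further input element. A strategy is a rule choosing each operation as a function only of the information revealed so far; it succeeds on $\pi$ if following it on input $\pi$ produces output $1,2,\dots,n$. *)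

theory Defs
  imports Main "HOL-Combinatorics.Multiset_Permutations"
begin

text \<open>A configuration consists of the remaining input (first element at the head), the deque from
  its left to its right end, and the output produced so far, in order of production.\<close>

type_synonym config = "nat list \<times> nat list \<times> nat list"

datatype deque_op = Push_Left | Push_Right | Pop_Left | Pop_Right

text \<open>The result is \<open>None\<close> if the operation is impossible.\<close>

fun deque_step :: "deque_op \<Rightarrow> config \<Rightarrow> config option" where
  "deque_step Push_Left (x # I, D, out) = Some (I, x # D, out)"
| "deque_step Push_Right (x # I, D, out) = Some (I, D @ [x], out)"
| "deque_step Pop_Left (I, x # D, out) = Some (I, D, out @ [x])"
| "deque_step Pop_Right (I, x # D, out) = Some (I, butlast (x # D), out @ [last (x # D)])"
| "deque_step _ _ = None"

fun deque_run :: "deque_op list \<Rightarrow> config \<Rightarrow> config option" where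
  "deque_run [] c = Some c"
| "deque_run (a # as) c = Option.bind (deque_step a c) (deque_run as)"

definition initial_config :: "nat list \<Rightarrow> config" where
  "initial_config p = (p, [], [])"

definition sorted_config :: "nat \<Rightarrow> config" where
  "sorted_config n = ([], [], [1..<Suc n])"

definition deque_sortable :: "nat list \<Rightarrow> bool" where
  "deque_sortable p \<longleftrightarrow>
     (\<exists>as. deque_run as (initial_config p) = Some (sorted_config (length p)))"

text \<open>In the game the player may also send the top card of the deck straight to the output, provided
  that it is the next element required.\<close>

datatype move = Send_Output | Deque_Op deque_op

fun game_step :: "move \<Rightarrow> config \<Rightarrow> config option" where
  "game_step Send_Output (x # I, D, out) =
     (if x = Suc (length out) then Some (I, D, out @ [x]) else None)"
| "game_step Send_Output ([], D, out) = None"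
| "game_step (Deque_Op a) c = deque_step a c"

text \<open>The cards seen when the deck \<open>p\<close> has been played down to \<open>I\<close>: those already taken from the
  deck and, if the deck is not exhausted, the card now on its top.\<close>

definition revealed :: "nat list \<Rightarrow> nat list \<Rightarrow> nat list" where
  "revealed p I = take (Suc (length p - length I)) p"

text \<open>A strategy chooses the next move from the size of the deck, the cards revealed so far (in
  order) and the moves made so far (in order).  The deque and the output are functions of the last
  two.\<close>

type_synonym strategy = "nat \<Rightarrow> nat list \<Rightarrow> move list \<Rightarrow> move"

text \<open>\<open>play s p h c\<close>: following \<open>s\<close> on the deck \<open>p\<close>, the moves \<open>h\<close> are made and lead to \<open>c\<close>.
  A strategy that chooses an impossible move gets stuck.\<close>

inductive play :: "strategy \<Rightarrow> nat list \<Rightarrow> move list \<Rightarrow> config \<Rightarrow> bool"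
  for s :: strategy and p :: "nat list" where
  start: "play s p [] (initial_config p)"
| step: "\<lbrakk>play s p h (I, D, out); m = s (length p) (revealed p I) h;
          game_step m (I, D, out) = Some c\<rbrakk> \<Longrightarrow> play s p (h @ [m]) c"

definition succeeds :: "strategy \<Rightarrow> nat list \<Rightarrow> bool" where
  "succeeds s p \<longleftrightarrow> (\<exists>h. play s p h (sorted_config (length p)))"

end

theory Submission
  imports Defs
begin

text \<open>The witnesses are \<open>5, 6, 2, 4, 1, 7, 3\<close> and \<open>5, 6, 2, 7, 1, 3, 4\<close>. A card that lies between
  two larger ones on the deque cannot leave it in time. When the common part \<open>5, 6, 2\<close> has been taken
  from the deck, 5 and 6 are adjacent on the deque and 2 is at one end. In the first deck, 4 must go
  to the end opposite 2, and 7 to the end opposite 4 after 1 and 2 have left; as 5 must not be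
  between 6 and 7, it is next to 4, so that 2 was placed next to 6. In the second deck, 7 must go to
  the end opposite 2; as 5 must not be between 6 and 7, this time 2 was placed next to 5. But a
  strategy has to place 2 without knowing which of the two decks it is playing.\<close>

section \<open>Plays as paths of game moves\<close>

definition game_move :: "config \<Rightarrow> config \<Rightarrow> bool" where
  "game_move c c' \<longleftrightarrow> (\<exists>m. game_step m c = Some c')"

lemma game_moveI: "game_step m c = Some c' \<Longrightarrow> game_move c c'"
  by (auto simp: game_move_def)

lemma play_imp_reachable:
  assumes "play s p h c"
  shows "game_move\<^sup>*\<^sup>* (initial_config p) c"
  using assms by induction (auto intro: rtranclp.rtrancl_into_rtrancl game_moveI)

text \<open>A strategy is a function of what the player has seen and done, so each stage of a play
  has at most one successor.\<close>

lemma play_deterministic: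
  assumes "play s p h c" "play s p h' c'" "length h = length h'"
  shows "h = h' \<and> c = c'"
  using assms
proof (induction arbitrary: h' c')
  case start
  then show ?case by (auto elim: play.cases)
next
  case (step h I D out m c)
  from step.prems obtain h1 I1 D1 out1 where
    "h' = h1 @ [s (length p) (revealed p I1) h1]" "play s p h1 (I1, D1, out1)"
    "game_step (s (length p) (revealed p I1) h1) (I1, D1, out1) = Some c'"
    by (auto elim: play.cases)
  with step.IH[of h1 "(I1, D1, out1)"] step.prems step.hyps show ?case by auto
qed

text \<open>By determinism all plays of \<open>s\<close> on \<open>p\<close> are stages of a single
  run; induction on the longer one walks back until the lengths agree.\<close>

lemma play_reaches_later:
  assumes "play s p h' c'" "play s p h c" "length h \<le> length h'"
  shows "game_move\<^sup>*\<^sup>* c c'"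
  using assms
proof induction
  case start
  then show ?case by (auto elim: play.cases)
next
  case (step h' I D out m c')
  show ?case
  proof (cases "length h \<le> length h'")
    case True
    with step show ?thesis by (meson game_moveI rtranclp.rtrancl_into_rtrancl)
  next
    case False
    with step.prems have "length h = length (h' @ [m])" by simp
    with step.prems play.step[OF step.hyps] show ?thesis
      using play_deterministic by blast
  qed
qed

section \<open>Play on two decks with a common beginning\<close>

text \<open>A move looks at and takes at most the top card, which lies in \<open>w\<close>, so what
  comes below \<open>w\<close> can be exchanged.\<close>

lemma game_step_common_prefix:
  assumes "game_step m (w @ u, D, out) = Some c" "w \<noteq> []"
  obtains w' D' out' where "c = (w' @ u, D', out')"
    "game_step m (w @ v, D, out) = Some (w' @ v, D', out')"
proof -
  obtain x w1 where w: "w = x # w1"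
    using assms(2) by (cases w) auto
  have "\<exists>w' D' out'. c = (w' @ u, D', out') \<and>
          game_step m (w @ v, D, out) = Some (w' @ v, D', out')"
  proof (cases m)
    case Send_Output
    with assms w show ?thesis by (auto split: if_splits)
  next
    case (Deque_Op a)
    with assms w show ?thesis by (cases a; cases D) (force split: if_splits)+
  qed
  with that show thesis by blast
qed

text \<open>A card that distinguishes the two decks is revealed only when their common part is used up,
  and hence the first configuration in which this is the case is the same for both, up to the rest
  of the deck.\<close>

lemma play_common_prefix:
  assumes "play s (pre @ u) h (I, D, out)" "length u = length v" "pre \<noteq> []"
  shows "(\<exists>w. w \<noteq> [] \<and> I = w @ u \<and> play s (pre @ v) h (w @ v, D, out)) \<or>
         (\<exists>h' D' out'. play s (pre @ u) h' (u, D', out') \<and> play s (pre @ v) h' (v, D', out'))"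
  using assms(1)
proof (induction h "(I, D, out)" arbitrary: I D out)
  case start
  with assms play.start[of s "pre @ v"] show ?case by (auto simp: initial_config_def)
next
  case (step h I D out m I' D' out')
  from step.hyps(2) show ?case
  proof (elim disjE exE conjE)
    fix w
    assume w: "w \<noteq> []" "I = w @ u" and play_v: "play s (pre @ v) h (w @ v, D, out)"
    from step.hyps(4) w obtain w' where w': "I' = w' @ u"
      "game_step m (w @ v, D, out) = Some (w' @ v, D', out')"
      by (auto elim: game_step_common_prefix)
    \<comment> \<open>The \<open>Suc\<close> counts the card on top of the deck. As \<open>w\<close>
      is nonempty, that card still belongs to \<open>pre\<close>, so the strategy sees the same
      cards on both decks and makes the same move.\<close>
    have "Suc (length pre - length w) \<le> length pre"
      using w assms(3) by (cases w; cases pre) auto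
    then have "revealed (pre @ v) (w @ v) = revealed (pre @ u) I"
      by (simp add: revealed_def w assms(2))
    with step.hyps(3) assms(2) have "m = s (length (pre @ v)) (revealed (pre @ v) (w @ v)) h"
      by simp
    from play.step[OF play_v this w'(2)] have "play s (pre @ v) (h @ [m]) (w' @ v, D', out')" .
    moreover have "play s (pre @ u) (h @ [m]) (I', D', out')"
      using step.hyps by (intro play.step) auto
    \<comment> \<open>An empty \<open>w'\<close> means that the last card of \<open>pre\<close> has
      just been taken: this is the shared configuration of the second alternative.\<close>
    ultimately show ?thesis
      using w'(1) by (cases "w' = []") auto
  qed blast
qed

lemma no_game_move_sorted_config: "\<not> game_move (sorted_config n) c"
proof
  assume "game_move (sorted_config n) c"
  then obtain m where "game_step m (sorted_config n) = Some c"
    by (auto simp: game_move_def)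
  then show False
  proof (cases m)
    case (Deque_Op a)
    with \<open>game_step m _ = _\<close> show ?thesis by (cases a) (auto simp: sorted_config_def)
  qed (auto simp: sorted_config_def)
qed

lemma succeeds_reachable:
  assumes "succeeds s p" "play s p h (I, D, out)" "I \<noteq> []"
  shows "game_move\<^sup>*\<^sup>* (I, D, out) (sorted_config (length p))"
proof -
  obtain h' where h': "play s p h' (sorted_config (length p))"
    using assms(1) by (auto simp: succeeds_def)
  show ?thesis
  proof (cases "length h \<le> length h'")
    case True
    with h' assms(2) show ?thesis by (rule play_reaches_later)
  next
    \<comment> \<open>The successful play would have ended before \<open>h\<close>; but no move
      leaves a sorted configuration, and its input is empty while \<open>I\<close> is not.\<close>
    case False
    with h' assms(2) have "game_move\<^sup>*\<^sup>* (sorted_config (length p)) (I, D, out)"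
      by (intro play_reaches_later) auto
    with assms(3) show ?thesis
      by (auto elim: converse_rtranclpE simp: no_game_move_sorted_config)
  qed
qed

text \<open>This eliminates the strategy: what remains is a reachability question about finitely
  many configurations.\<close>

lemma succeeds_common_prefix:
  assumes "succeeds s (pre @ u)" "succeeds s (pre @ v)"
    and "length u = length v" "pre \<noteq> []" "u \<noteq> []" "length (pre @ u) = n"
  obtains D out where "game_move\<^sup>*\<^sup>* (initial_config (pre @ u)) (u, D, out)"
    "game_move\<^sup>*\<^sup>* (u, D, out) (sorted_config n)"
    "game_move\<^sup>*\<^sup>* (v, D, out) (sorted_config n)"
proof -
  \<comment> \<open>The input is empty at the end, whereas \<open>w @ u\<close> is not; this
    excludes the first alternative of \<open>play_common_prefix\<close>.\<close>
  obtain h where "play s (pre @ u) h ([], [], [1..<Suc (length (pre @ u))])"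
    using assms(1) by (auto simp: succeeds_def sorted_config_def)
  from play_common_prefix[OF this assms(3,4)] assms(5) obtain h' D out where
    plays: "play s (pre @ u) h' (u, D, out)" "play s (pre @ v) h' (v, D, out)"
    by auto
  have "v \<noteq> []" "length (pre @ v) = n"
    using assms by auto
  show thesis
    using that[of D out] play_imp_reachable[OF plays(1)]
      succeeds_reachable[OF assms(1) plays(1) assms(5)]
      succeeds_reachable[OF assms(2) plays(2) \<open>v \<noteq> []\<close>]
    unfolding assms(6) \<open>length (pre @ v) = n\<close> by blast
qed

section \<open>Exhaustive search with pruning\<close>

definition correct_output :: "config \<Rightarrow> bool" where
  "correct_output = (\<lambda>(I, D, out). out = [1..<Suc (length out)])"

text \<open>An upper bound for the length of the remaining game: a card in the input allows a push
  and a pop, a card on the deque a pop.\<close>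

fun moves_left :: "config \<Rightarrow> nat" where
  "moves_left (I, D, out) = 2 * length I + length D"

lemma game_step_Some:
  assumes "game_step m (I, D, out) = Some (I', D', out')"
  shows "moves_left (I', D', out') < moves_left (I, D, out)" "\<exists>xs. out' = out @ xs"
proof -
  have "moves_left (I', D', out') < moves_left (I, D, out) \<and> (\<exists>xs. out' = out @ xs)"
  proof (cases m)
    case Send_Output
    with assms show ?thesis by (cases I) (auto split: if_splits)
  next
    case (Deque_Op a)
    with assms show ?thesis by (cases a; cases I; cases D) (auto split: if_splits)
  qed
  then show "moves_left (I', D', out') < moves_left (I, D, out)" "\<exists>xs. out' = out @ xs"
    by auto
qed

text \<open>Output is never taken back, so a wrong output cannot be repaired and the search may
  discard it.\<close>

lemma correct_output_game_step:
  assumes "game_step m c = Some c'" "correct_output c'"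
  shows "correct_output c"
proof -
  obtain I D out I' D' out' where c: "c = (I, D, out)" "c' = (I', D', out')"
    by (cases c, cases c') auto
  with assms game_step_Some(2)[of m] obtain xs where "out' = out @ xs"
    by blast
  with assms(2) c have "out = take (length out) [1..<Suc (length out + length xs)]"
    by (metis (mono_tags, lifting) append_eq_conv_conj case_prod_conv correct_output_def
        length_append)
  also have "\<dots> = [1..<Suc (length out)]"
    by (simp del: upt_Suc)
  finally show ?thesis
    using c by (simp add: correct_output_def)
qed

lemma moves_left_antimono: "game_move\<^sup>*\<^sup>* c c' \<Longrightarrow> moves_left c' \<le> moves_left c"
proof (induction rule: rtranclp_induct)
  case (step d e)
  then have "moves_left e < moves_left d"
    by (cases d, cases e) (auto simp: game_move_def dest!: game_step_Some(1))
  with step.IH show ?case by simp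
qed simp

definition all_moves :: "move list" where
  "all_moves = [Send_Output, Deque_Op Push_Left, Deque_Op Push_Right, Deque_Op Pop_Left,
     Deque_Op Pop_Right]"

lemma in_all_moves: "m \<in> set all_moves"
proof (cases m)
  case (Deque_Op a)
  then show ?thesis by (cases a) (auto simp: all_moves_def)
qed (auto simp: all_moves_def)

text \<open>Conditionals instead of conjunctions make the simplifier cut off the search: it evaluates both
  conjuncts of a conjunction.\<close>

primrec search :: "(config \<Rightarrow> bool) \<Rightarrow> nat \<Rightarrow> config \<Rightarrow> bool" where
  "search P 0 c = P c"
| "search P (Suc k) c = (P c \<or> list_ex (\<lambda>m. case game_step m c of
      None \<Rightarrow> False | Some c' \<Rightarrow> if correct_output c' then search P k c' else False) all_moves)"

text \<open>Used in contrapositive form: a failed search proves unreachability. The depth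
  \<open>k\<close> suffices because every move lowers \<open>moves_left\<close>.\<close>

lemma search_complete:
  assumes "game_move\<^sup>*\<^sup>* c c'" "P c'" "correct_output c'" "moves_left c \<le> k + moves_left c'"
  shows "search P k c \<and> correct_output c"
  using assms
proof (induction arbitrary: k rule: converse_rtranclp_induct)
  case base
  then show ?case by (cases k) auto
next
  case (step c d)
  then obtain m where m: "game_step m c = Some d"
    by (auto simp: game_move_def)
  then have "moves_left d < moves_left c"
    by (cases c, cases d) (auto dest!: game_step_Some(1))
  moreover have "moves_left c' \<le> moves_left d"
    using step.hyps(2) by (rule moves_left_antimono)
  ultimately obtain k' where "k = Suc k'" "moves_left d \<le> k' + moves_left c'"
    using step.prems by (cases k) auto
  moreover with step have "search P k' d" "correct_output d"
    by auto
  ultimately show ?case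
    using m in_all_moves[of m] correct_output_game_step[OF m]
    by (auto simp: list_ex_iff intro!: bexI[of _ m])
qed

lemma correct_output_sorted_config: "correct_output (sorted_config n)"
  by (simp add: correct_output_def sorted_config_def)

section \<open>The two decks\<close>

text \<open>The outer search runs through the ways to play 5, 6, 2, the inner ones try to finish
  both decks from there. Taking three cards costs at most 6 moves, the whole game at most
  14.\<close>

lemma search_fails:
  "\<not> search (\<lambda>(I, D, out). if I = [4, 1, 7, 3] then
        if search (\<lambda>c. c = sorted_config 7) 14 ([4, 1, 7, 3], D, out)
        then search (\<lambda>c. c = sorted_config 7) 14 ([7, 1, 3, 4], D, out) else False else False)
      6 (initial_config [5, 6, 2, 4, 1, 7, 3])"
  by code_simp

lemma no_common_strategy:
  "\<not> (succeeds s [5, 6, 2, 4, 1, 7, 3] \<and> succeeds s [5, 6, 2, 7, 1, 3, 4])"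
proof
  let ?u = "[4, 1, 7, 3] :: nat list" and ?v = "[7, 1, 3, 4] :: nat list"
  let ?wins = "search (\<lambda>c. c = sorted_config 7) 14"
  let ?P = "\<lambda>(I, D, out). if I = ?u then
    if ?wins (?u, D, out) then ?wins (?v, D, out) else False else False"
  assume "succeeds s [5, 6, 2, 4, 1, 7, 3] \<and> succeeds s [5, 6, 2, 7, 1, 3, 4]"
  then have "succeeds s ([5, 6, 2] @ ?u)" "succeeds s ([5, 6, 2] @ ?v)"
    by simp_all
  then obtain D out where reach: "game_move\<^sup>*\<^sup>* (initial_config ([5, 6, 2] @ ?u)) (?u, D, out)"
    and sorted: "game_move\<^sup>*\<^sup>* (?u, D, out) (sorted_config 7)"
      "game_move\<^sup>*\<^sup>* (?v, D, out) (sorted_config 7)"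
    by (rule succeeds_common_prefix[where n = 7]) simp_all
  \<comment> \<open>\<open>moves_left\<close> depends on the input only through its length, so the
    bound for \<open>?u\<close> holds for \<open>?v\<close> too.\<close>
  from moves_left_antimono[OF reach] have left:
    "moves_left (?u, D, out) \<le> 14 + moves_left (sorted_config 7)"
    "moves_left (?v, D, out) \<le> 14 + moves_left (sorted_config 7)"
    by (simp_all add: initial_config_def)
  have wins: "?wins (?u, D, out) \<and> correct_output (?u, D, out)"
    by (rule search_complete[OF sorted(1) _ correct_output_sorted_config left(1)]) (rule refl)
  have wins': "?wins (?v, D, out) \<and> correct_output (?v, D, out)"
    by (rule search_complete[OF sorted(2) _ correct_output_sorted_config left(2)]) (rule refl)
  have "?P (?u, D, out)"
    unfolding case_prod_conv using wins wins' by presburger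
  moreover have "moves_left (initial_config ([5, 6, 2] @ ?u)) \<le> 6 + moves_left (?u, D, out)"
    by (simp add: initial_config_def)
  ultimately have "search ?P 6 (initial_config ([5, 6, 2] @ ?u))"
    using search_complete[OF reach, of ?P 6] wins by blast
  with search_fails show False
    unfolding append.simps by blast
qed

theorem theorem10p1:
  shows "(\<not> (\<exists>s :: strategy. \<forall>n :: nat. \<forall>p \<in> permutations_of_set {1..n}.
              deque_sortable p \<longrightarrow> succeeds s p)) \<and>
         (\<exists>p \<in> permutations_of_set {1..7 :: nat}. \<exists>q \<in> permutations_of_set {1..7 :: nat}.
              p \<noteq> q \<and> deque_sortable p \<and> deque_sortable q \<and>
              (\<forall>s :: strategy. \<not> succeeds s p \<or> \<not> succeeds s q))"
proof -
  let ?p = "[5, 6, 2, 4, 1, 7, 3] :: nat list" and ?q = "[5, 6, 2, 7, 1, 3, 4] :: nat list"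
  have perms: "?p \<in> permutations_of_set {1..7}" "?q \<in> permutations_of_set {1..7}"
    by (auto simp: permutations_of_set_def)
  have sortable: "deque_sortable ?p" "deque_sortable ?q"
  proof -
    \<comment> \<open>The two runs first differ at card 2: it goes next to 6 here and next to 5 for
      \<open>?q\<close>.\<close>
    have "deque_run
        [Push_Left, Push_Right, Push_Right, Push_Left, Push_Left, Pop_Left, Pop_Right, Push_Right,
         Push_Left, Pop_Left, Pop_Left, Pop_Left, Pop_Left, Pop_Left] (initial_config ?p) =
        Some (sorted_config (length ?p))"
      by code_simp
    then show "deque_sortable ?p"
      unfolding deque_sortable_def by blast
    have "deque_run
        [Push_Left, Push_Right, Push_Left, Push_Right, Push_Left, Pop_Left, Pop_Left, Push_Left,
         Pop_Left, Push_Left, Pop_Left, Pop_Left, Pop_Left, Pop_Left] (initial_config ?q) =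
        Some (sorted_config (length ?q))"
      by code_simp
    then show "deque_sortable ?q"
      unfolding deque_sortable_def by blast
  qed
  have fails: "\<not> succeeds s ?p \<or> \<not> succeeds s ?q" for s
    using no_common_strategy by blast
  show ?thesis
  proof (intro conjI)
    show "\<not> (\<exists>s :: strategy. \<forall>n :: nat. \<forall>p \<in> permutations_of_set {1..n}.
        deque_sortable p \<longrightarrow> succeeds s p)"
    proof
      assume "\<exists>s :: strategy. \<forall>n :: nat. \<forall>p \<in> permutations_of_set {1..n}.
        deque_sortable p \<longrightarrow> succeeds s p"
      then obtain s :: strategy where
        "deque_sortable p \<Longrightarrow> succeeds s p" if "p \<in> permutations_of_set {1..7}" for p
        by blast
      from this[OF perms(1) sortable(1)] this[OF perms(2) sortable(2)] fails[of s] show False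
        by (elim disjE notE)
    qed
    show "\<exists>p \<in> permutations_of_set {1..7 :: nat}. \<exists>q \<in> permutations_of_set {1..7 :: nat}.
        p \<noteq> q \<and> deque_sortable p \<and> deque_sortable q \<and>
        (\<forall>s :: strategy. \<not> succeeds s p \<or> \<not> succeeds s q)"
      by (intro bexI[OF _ perms(1)] bexI[OF _ perms(2)] conjI sortable allI fails) simp
  qed
qed

end
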